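(* $\mathfrak{sp}(\mathrm{Borel})$ is closed under singular limits: for every singular cardinal $\kappa$, if $\mathfrak{sp}(\mathrm{Borel}) \cap \kappa$ is unbounded in $\kappa$, then $\kappa \in \mathfrak{sp}(\mathrm{Borel})$.
   Context: A partition of a set is a family of pairwise disjoint nonempty subsets whose union is the whole set. $\mathfrak{sp}(\mathrm{Borel}) = \{|\mathcal P| : \mathcal P \text{ is a partition of } \mathbb{R} \text{ into uncountably many Borel sets}\}$. *)

theory Defs
  imports "HOL-Analysis.Analysis"
begin

unbundle cardinal_syntax

(* A cardinal is an initial ordinal up to isomorphism, i.e. a relation r with Card_order r. The
   relation |P| =o k makes k a Card_order. The carrier type 'a is arbitrary, and every cardinal
   or ordinal below some k :: 'a rel has a copy of type 'a rel, so one carrier type is enough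
   to speak about k and everything below it. *)
definition sp_Borel :: "'a rel set" where
  "sp_Borel = {k. \<exists>P :: real set set.
     partition_on UNIV P \<and> P \<subseteq> sets borel \<and> uncountable P \<and> |P| =o k}"

definition singular_cardinal :: "'a rel \<Rightarrow> bool" where
  "singular_cardinal k \<longleftrightarrow> Cinfinite k \<and> \<not> regularCard k"

(* Here a ranges over all ordinals below k, not only cardinals: a <o k holds only for
   well-orders a. *)
definition unbounded_in :: "'a rel set \<Rightarrow> 'a rel \<Rightarrow> bool" where
  "unbounded_in S k \<longleftrightarrow> (\<forall>a :: 'a rel. a <o k \<longrightarrow> (\<exists>l \<in> S. l <o k \<and> a <o l))"

end

theory Submission
  imports Defs
begin

text \<open>Let \<open>K\<close> be cofinal in \<open>\<kappa>\<close> with fewer than \<open>\<kappa>\<close> elements. Take a Borel partition \<open>P\<close> of the line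
  with \<open>|K| < |P| < \<kappa>\<close> and choose distinct elements of \<open>P\<close> indexed by \<open>K\<close>. In the plane, cut the strip
  \<open>X \<times> \<real>\<close> over the \<open>b\<close>-th chosen \<open>X\<close> into \<open>\<lambda> b\<close> pieces along a Borel partition of the second
  coordinate, where \<open>b < \<lambda> b < \<kappa>\<close>, and every other strip into \<open>|P|\<close> pieces. This gives exactly \<open>\<kappa>\<close>
  pieces in total. Working in the plane avoids having to split a countable \<open>X\<close>, and a Borel surjection
  of the line onto the plane pulls the partition back.\<close>

text \<open>Scaling by \<open>4 ^ n\<close> turns each digit before position \<open>n\<close> into a
  multiple of 4 and leaves digit \<open>n\<close> as the unit. Since the digits are only 0 and 1,
  the remaining tail is at most 1/3, so the floor drops exactly that tail.\<close>

lemma floor_base4_digits: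
  fixes s :: "nat \<Rightarrow> bool"
  shows "odd \<lfloor>4 ^ n * (\<Sum>k. of_bool (s k) / 4 ^ k :: real)\<rfloor> \<longleftrightarrow> s n"
proof -
  define f :: "nat \<Rightarrow> real" where "f k = of_bool (s k) / 4 ^ k" for k
  have geo: "summable (\<lambda>k. (1 / 4 :: real) ^ k)"
    by (rule summable_geometric) simp
  have f_le: "0 \<le> f k" "f k \<le> (1 / 4) ^ k" for k
    by (auto simp: f_def power_divide)
  have f: "summable f"
    by (rule summable_comparison_test'[OF geo, of 0]) (use f_le in auto)
  define t where "t = 4 ^ n * (\<Sum>k. f (k + Suc n))"
  have "(\<Sum>k. f (k + Suc n)) \<le> (\<Sum>k. (1 / 4) ^ Suc n * (1 / 4) ^ k)"
  proof (rule suminf_le)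
    show "f (k + Suc n) \<le> (1 / 4) ^ Suc n * (1 / 4) ^ k" for k
      using f_le(2)[of "k + Suc n"] by (simp add: power_add mult_ac)
    show "summable (\<lambda>k. f (k + Suc n))"
      using f by (rule summable_ignore_initial_segment)
    show "summable (\<lambda>k. (1 / 4) ^ Suc n * (1 / 4 :: real) ^ k)"
      using geo by (rule summable_mult)
  qed
  also have "\<dots> = (1 / 4) ^ Suc n * (4 / 3)"
    by (subst suminf_mult[OF geo], subst suminf_geometric) auto
  finally have "t \<le> 4 ^ n * ((1 / 4) ^ Suc n * (4 / 3))"
    unfolding t_def by (rule mult_left_mono) simp
  also have "\<dots> = 1 / 3"
    by (simp add: power_divide)
  finally have "t < 1" by simp
  have "0 \<le> t"
    unfolding t_def by (intro mult_nonneg_nonneg suminf_nonneg summable_ignore_initial_segment f f_le) auto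
  define m :: int where "m = (\<Sum>k<n. of_bool (s k) * 4 ^ (n - k))"
  have "even m"
    unfolding m_def by (intro dvd_sum) auto
  have "4 ^ n * f k = of_bool (s k) * 4 ^ (n - k)" if "k < n" for k
    using that by (simp add: f_def power_diff)
  hence "4 ^ n * (\<Sum>k<n. f k) = of_int m"
    by (simp add: m_def sum_distrib_left)
  moreover have "suminf f = (\<Sum>k. f (k + Suc n)) + (\<Sum>k<Suc n. f k)"
    using f by (rule suminf_split_initial_segment)
  moreover have "4 ^ n * f n = of_bool (s n)"
    by (simp add: f_def)
  ultimately have "4 ^ n * suminf f = of_int (m + of_bool (s n)) + t"
    by (simp add: t_def algebra_simps)
  hence "\<lfloor>4 ^ n * suminf f\<rfloor> = m + of_bool (s n)"
    using \<open>0 \<le> t\<close> \<open>t < 1\<close> by (intro floor_unique) auto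
  moreover have "suminf f = (\<Sum>k. of_bool (s k) / 4 ^ k)"
    unfolding f_def ..
  ultimately show ?thesis
    using \<open>even m\<close> by auto
qed

text \<open>This decodes a real from the set of rationals below it. In \<open>ereal\<close> the
  supremum always exists, and the value -\<infinity> makes the other rationals harmless.\<close>

lemma SUP_rationals_below:
  fixes a :: real
  shows "(SUP n. if of_rat (from_nat n) < a then ereal (of_rat (from_nat n)) else -\<infinity>) = ereal a"
    (is "(SUP n. ?e n) = _")
proof (rule antisym)
  show "(SUP n. ?e n) \<le> ereal a"
    by (intro SUP_least) auto
  show "ereal a \<le> (SUP n. ?e n)"
  proof (rule dense_le)
    fix y assume "y < ereal a"
    then obtain b where b: "y < ereal b" "b < a"
      using ereal_dense2 by (metis less_ereal.simps(1))
    obtain q :: rat where q: "b < of_rat q" "of_rat q < a"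
      using of_rat_dense[OF b(2)] by blast
    have "y \<le> ?e (to_nat q)"
      using b q by (auto intro: order_trans[OF less_imp_le])
    also have "\<dots> \<le> (SUP n. ?e n)"
      by (rule SUP_upper) simp
    finally show "y \<le> (SUP n. ?e n)" .
  qed
qed

text \<open>A real number is coded by the set of rationals below it; two such sets are interleaved as
  the even and odd base-4 digits of one real. Using only the digits 0 and 1 in base 4
  keeps the expansion unambiguous.\<close>

lemma borel_surjection_real_pair:
  obtains g h :: "real \<Rightarrow> real"
  where "g \<in> borel_measurable borel" "h \<in> borel_measurable borel" "surj (\<lambda>x. (g x, h x))"
proof -
  \<comment> \<open>The function \<open>j\<close> selects the digit positions to be read. Where the
    supremum is infinite, \<open>real_of_ereal\<close> returns 0; such \<open>x\<close> code no
    real.\<close>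
  define dec :: "(nat \<Rightarrow> nat) \<Rightarrow> real \<Rightarrow> real" where
    "dec j x = real_of_ereal
      (SUP n. if odd \<lfloor>4 ^ j n * x\<rfloor> then ereal (of_rat (from_nat n)) else -\<infinity>)" for j x
  have meas: "dec j \<in> borel_measurable borel" for j
    unfolding dec_def by measurable
  have "\<exists>x. (a, b) = (dec (\<lambda>n. 2 * n) x, dec (\<lambda>n. 2 * n + 1) x)" for a b
  proof -
    define s where "s k \<longleftrightarrow> of_rat (from_nat (k div 2)) < (if even k then a else b)" for k :: nat
    have "s (2 * n) \<longleftrightarrow> of_rat (from_nat n) < a" "s (2 * n + 1) \<longleftrightarrow> of_rat (from_nat n) < b" for n
      by (simp_all add: s_def)
    thus ?thesis
      by (intro exI[of _ "\<Sum>k. of_bool (s k) / 4 ^ k"])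
        (simp only: dec_def floor_base4_digits SUP_rationals_below real_of_ereal.simps)
  qed
  hence "surj (\<lambda>x. (dec (\<lambda>n. 2 * n) x, dec (\<lambda>n. 2 * n + 1) x))"
    by (auto simp: surj_def)
  with meas show thesis
    by (intro that)
qed

text \<open>The rectangles \<open>X \<times> Y\<close> partition the plane. By surjectivity no
  preimage of a rectangle is empty, so distinct rectangles keep distinct preimages and the pieces
  can be counted by \<open>Sigma P R\<close>.\<close>

lemma partition_on_vimage_Sigma:
  assumes surj: "surj (\<lambda>x. (g x, h x))"
    and P: "partition_on UNIV P"
    and R: "\<And>X. X \<in> P \<Longrightarrow> partition_on UNIV (R X)"
  shows "inj_on (\<lambda>(X, Y). g -` X \<inter> h -` Y) (Sigma P R)"
    and "partition_on UNIV ((\<lambda>(X, Y). g -` X \<inter> h -` Y) ` Sigma P R)"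
proof -
  have nonempty: "g -` X \<inter> h -` Y \<noteq> {}" if "X \<in> P" "Y \<in> R X" for X Y
  proof -
    have "X \<noteq> {}" "Y \<noteq> {}"
      using that P R[of X] by (auto simp: partition_on_def)
    then obtain a b where "a \<in> X" "b \<in> Y" by blast
    moreover obtain x where "(a, b) = (g x, h x)"
      using surj by (meson surjD)
    ultimately show ?thesis by auto
  qed
  have eq: "X = X' \<and> Y = Y'"
    if "X \<in> P" "Y \<in> R X" "X' \<in> P" "Y' \<in> R X'" "g x \<in> X" "h x \<in> Y" "g x \<in> X'" "h x \<in> Y'"
    for X Y X' Y' x
  proof -
    have "X = X'"
      using P that by (auto simp: partition_on_def disjoint_def)
    moreover from this have "Y = Y'"
      using R[of X] that by (auto simp: partition_on_def disjoint_def)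
    ultimately show ?thesis ..
  qed
  show "inj_on (\<lambda>(X, Y). g -` X \<inter> h -` Y) (Sigma P R)"
  proof (rule inj_onI, clarify)
    fix X Y X' Y'
    assume *: "X \<in> P" "Y \<in> R X" "X' \<in> P" "Y' \<in> R X'" "g -` X \<inter> h -` Y = g -` X' \<inter> h -` Y'"
    then obtain x where "g x \<in> X" "h x \<in> Y" "g x \<in> X'" "h x \<in> Y'"
      using nonempty[of X Y] by blast
    with * show "X = X' \<and> Y = Y'"
      using eq by blast
  qed
  show "partition_on UNIV ((\<lambda>(X, Y). g -` X \<inter> h -` Y) ` Sigma P R)"
  proof (rule partition_onI)
    have "\<exists>X\<in>P. \<exists>Y\<in>R X. g x \<in> X \<and> h x \<in> Y" for x
    proof -
      obtain X where "X \<in> P" "g x \<in> X"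
        using P by (metis UNIV_I UnionE partition_on_def)
      moreover from this obtain Y where "Y \<in> R X" "h x \<in> Y"
        using R[of X] by (metis UNIV_I UnionE partition_on_def)
      ultimately show ?thesis by blast
    qed
    thus "\<Union> ((\<lambda>(X, Y). g -` X \<inter> h -` Y) ` Sigma P R) = UNIV"
      by fastforce
  next
    fix p q
    assume "p \<in> (\<lambda>(X, Y). g -` X \<inter> h -` Y) ` Sigma P R"
      "q \<in> (\<lambda>(X, Y). g -` X \<inter> h -` Y) ` Sigma P R" "p \<noteq> q"
    moreover from this obtain X Y where "X \<in> P" "Y \<in> R X" and p: "p = g -` X \<inter> h -` Y"
      by auto
    moreover from calculation obtain X' Y' where "X' \<in> P" "Y' \<in> R X'"
      and q: "q = g -` X' \<inter> h -` Y'"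
      by auto
    ultimately show "disjnt p q"
      using eq[of X Y X' Y'] by (auto simp: disjnt_def)
  next
    show "{} \<notin> (\<lambda>(X, Y). g -` X \<inter> h -` Y) ` Sigma P R"
      using nonempty by auto
  qed
qed

text \<open>If \<open>|A|\<close> were below \<open>r\<close>, it would be the order type of the
  segment below some \<open>a\<close>. A member \<open>b\<close> of \<open>K\<close> strictly above
  \<open>a\<close> has a segment at least as long, yet shorter than \<open>|A|\<close>.\<close>

lemma Card_order_ordLeq_cofinal:
  assumes r: "Card_order r" and "cofinal K r"
    and K: "\<And>b. b \<in> K \<Longrightarrow> Restr r (underS r b) <o |A|"
  shows "r \<le>o |A|"
proof (rule ccontr)
  have wo: "Well_order r"
    using r by (rule card_order_on_well_order_on)
  assume "\<not> r \<le>o |A|"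
  hence "|A| <o r"
    using ordLess_or_ordLeq[OF card_of_Well_order wo] by blast
  then obtain a where a: "a \<in> Field r" "|A| =o Restr r (underS r a)"
    using ordLess_iff_ordIso_Restr[OF wo card_of_Well_order] by blast
  then obtain b where b: "b \<in> K" "a \<noteq> b" "(a, b) \<in> r"
    using \<open>cofinal K r\<close> unfolding cofinal_def by blast
  have "underS r a \<subseteq> underS r b"
    using wo b underS_incr[of r a b]
    by (auto simp: well_order_on_def linear_order_on_def partial_order_on_def preorder_on_def)
  hence "Restr r (underS r a) \<le>o Restr r (underS r b)"
    using wo by (simp add: ofilter_subset_ordLeq wo_rel.underS_ofilter wo_rel_def)
  with a K[OF b(1)] have "|A| <o |A|"
    using ordIso_ordLeq_trans ordLeq_ordLess_trans by blast
  thus False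
    using ordLess_irreflexive by blast
qed

theorem theorem2p8:
  fixes \<kappa> :: "'a rel"
  assumes "singular_cardinal \<kappa>"
    and "unbounded_in (sp_Borel \<inter> {\<mu>. \<mu> <o \<kappa>}) \<kappa>"
  shows "\<kappa> \<in> sp_Borel"
proof -
  have Cinf: "Cinfinite \<kappa>" and card: "Card_order \<kappa>" and wo: "Well_order \<kappa>"
    using assms(1) by (auto simp: singular_cardinal_def card_order_on_well_order_on)
  have part: "\<exists>P :: real set set. partition_on UNIV P \<and> P \<subseteq> sets borel \<and> uncountable P \<and>
      |P| <o \<kappa> \<and> a <o |P|" if a: "a <o \<kappa>" for a :: "'a rel"
  proof -
    obtain l :: "'a rel" where l: "l \<in> sp_Borel" "l <o \<kappa>" "a <o l"
      using assms(2) a unfolding unbounded_in_def by blast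
    then obtain P :: "real set set" where
      P: "partition_on UNIV P" "P \<subseteq> sets borel" "uncountable P" "|P| =o l"
      unfolding sp_Borel_def by blast
    have "|P| <o \<kappa>" "a <o |P|"
      using l P(4) ordIso_ordLess_trans ordLess_ordIso_trans ordIso_symmetric by blast+
    with P show ?thesis by blast
  qed
  obtain K where K: "K \<subseteq> Field \<kappa>" "cofinal K \<kappa>" "\<not> |K| =o \<kappa>"
    using assms(1) by (auto simp: singular_cardinal_def regularCard_def)
  have "|K| \<le>o \<kappa>"
    using card_of_mono1[OF K(1)] card_of_Field_ordIso[OF card] ordLeq_ordIso_trans by blast
  hence "|K| <o \<kappa>"
    using K(3) ordLeq_iff_ordLess_or_ordIso by blast
  then obtain P :: "real set set" where P: "partition_on UNIV P" "P \<subseteq> sets borel" "uncountable P"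
    and P_less: "|P| <o \<kappa>" and "|K| <o |P|"
    using part by blast
  then obtain i where i: "inj_on i K" "i ` K \<subseteq> P"
    using card_of_ordLeq ordLess_imp_ordLeq by metis
  \<comment> \<open>The segment below \<open>b\<close> represents \<open>b\<close> as an ordinal
    smaller than \<kappa>.\<close>
  have "\<exists>Q :: real set set. partition_on UNIV Q \<and> Q \<subseteq> sets borel \<and>
      |Q| <o \<kappa> \<and> Restr \<kappa> (underS \<kappa> b) <o |Q|" if "b \<in> K" for b
    using part[of "Restr \<kappa> (underS \<kappa> b)"] underS_Restr_ordLess[OF wo, of b] that K(1) by blast
  then obtain Q :: "'a \<Rightarrow> real set set" where
    Q: "partition_on UNIV (Q b)" "Q b \<subseteq> sets borel" "|Q b| <o \<kappa>"
      "Restr \<kappa> (underS \<kappa> b) <o |Q b|" if "b \<in> K" for b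
    by metis
  define R where "R X = (if X \<in> i ` K then Q (the_inv_into K i X) else P)" for X
  have Ri: "R (i b) = Q b" if "b \<in> K" for b
    using i that by (simp add: R_def the_inv_into_f_f)
  have R: "partition_on UNIV (R X) \<and> R X \<subseteq> sets borel \<and> |R X| \<le>o \<kappa>" for X
  proof (cases "X \<in> i ` K")
    case True
    then obtain b where "b \<in> K" "X = i b" by blast
    thus ?thesis
      using Q(1-3)[of b] Ri ordLess_imp_ordLeq by metis
  next
    case False
    thus ?thesis
      using P(1,2) ordLess_imp_ordLeq[OF P_less] by (simp add: R_def)
  qed
  obtain g h :: "real \<Rightarrow> real" where
    gh: "g \<in> borel_measurable borel" "h \<in> borel_measurable borel" "surj (\<lambda>x. (g x, h x))"
    by (rule borel_surjection_real_pair)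
  define S where "S = (\<lambda>(X, Y). g -` X \<inter> h -` Y) ` Sigma P R"
  have S: "partition_on UNIV S" and "inj_on (\<lambda>(X, Y). g -` X \<inter> h -` Y) (Sigma P R)"
    unfolding S_def using partition_on_vimage_Sigma[where R = R, OF gh(3) P(1)] R by blast+
  hence "|Sigma P R| =o |S|"
    unfolding S_def by (metis card_of_ordIsoI inj_on_imp_bij_betw)
  have borel: "S \<subseteq> sets borel"
  proof -
    have "g -` X \<inter> h -` Y \<in> sets borel" if "X \<in> P" "Y \<in> R X" for X Y
      using that P(2) R[of X] measurable_sets_borel[OF gh(1)] measurable_sets_borel[OF gh(2)] by blast
    thus ?thesis by (auto simp: S_def)
  qed
  \<comment> \<open>Fewer than \<kappa> strips with at most \<kappa> pieces each: \<kappa> is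
    infinite, so the total is at most \<kappa>.\<close>
  have "|Sigma P R| \<le>o \<kappa>"
    using Cinf P_less R
    by (intro card_of_Sigma_ordLeq_infinite_Field) (auto simp: cinfinite_def ordLess_imp_ordLeq)
  hence upper: "|S| \<le>o \<kappa>"
    using \<open>|Sigma P R| =o |S|\<close> ordIso_symmetric ordIso_ordLeq_trans by blast
  have Q_le: "|Q b| \<le>o |S|" if "b \<in> K" for b
  proof -
    \<comment> \<open>The strip over \<open>i b\<close> alone contributes a copy of
      \<open>Q b\<close>.\<close>
    have "Pair (i b) ` Q b \<subseteq> Sigma P R"
      using i(2) Ri that by auto
    hence "|Q b| \<le>o |Sigma P R|"
      by (meson card_of_ordLeq inj_on_def prod.inject)
    thus ?thesis
      using \<open>|Sigma P R| =o |S|\<close> ordLeq_ordIso_trans by blast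
  qed
  have lower: "\<kappa> \<le>o |S|"
    using Card_order_ordLeq_cofinal[OF card K(2)] Q(4) Q_le ordLess_ordLeq_trans by blast
  \<comment> \<open>Uncountability of \<open>S\<close> is inherited from \<open>P\<close>, whose
    size lies below \<kappa>.\<close>
  have "|P| \<le>o |S|"
    using P_less lower ordLess_ordLeq_trans ordLess_imp_ordLeq by blast
  hence "uncountable S"
    using P(3) by (meson card_of_ordLeq countable_image_inj_on countable_subset)
  moreover have "|S| =o \<kappa>"
    using upper lower by (simp add: ordIso_iff_ordLeq)
  ultimately show ?thesis
    using S borel by (auto simp: sp_Borel_def)
qed

end
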